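(* For all strings $s\in\Sigma^*$ and regexes $R\in\mathcal{R}$ the following hold: (1) $\mathit{llMatch}(s,R)=\mathsf{fail}$ if and only if there exist no $i,j$ with $s\langle i\rangle\xrightarrow{R}s\langle j\rangle$ (where $s\langle i\rangle,s\langle j\rangle$ are valid locations); (2) if $\mathit{llMatch}(s,R)\ne\mathsf{fail}$ then $\mathit{llMatch}(s,R)$ is the POSIX match for $R$ in $s$.
   Context: **Alphabet.** $\Sigma$ is a domain of characters, and $(\Sigma,\Psi,[\![\cdot]\!],\bot,\top,\vee,\wedge,\neg)$ is an effective Boolean algebra over $\Sigma$: $\Psi$ is a set of predicates closed under the connectives, $[\![\cdot]\!]:\Psi\to 2^\Sigma$, $[\![\bot]\!]=\emptyset$, $[\![\top]\!]=\Sigma$, $[\![\varphi\vee\psi]\!]=[\![\varphi]\!]\cup[\![\psi]\!]$, $[\![\varphi\wedge\psi]\!]=[\![\varphi]\!]\cap[\![\psi]\!]$, $[\![\neg\varphi]\!]=\Sigma\setminus[\![\varphi]\!]$. **Strings and locations.** For $s\in\Sigma^*$, $|s|$ is its length, $s_i$ ($0\le i<|s|$) its $i$-th character (indexing from 0), and $s_{-1}=s_{|s|}=\epsilon$ (the empty string, which belongs to no $[\![\psi]\!]$). $s^r$ is the reverse of $s$. A location in $s$ is a pair $s\langle i\rangle=\langle s,i\rangle$ with $-1\le i\le|s|$; it is valid if $0\le i\le|s|$ and final if $i=|s|$. Locations are ordered by position: $s\langle i\rangle<s\langle j\rangle$ iff $i<j$; $s\langle i\rangle+1=s\langle i+1\rangle$.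 The reverse of a valid location is $s\langle i\rangle^r=s^r\langle|s|-i\rangle$. The match failure is $\mathsf{fail}=\epsilon\langle-1\rangle$, and $\max(x,\mathsf{fail})=\max(\mathsf{fail},x)=x$. **Regexes.** $\mathcal{R}$ is generated by $$R::=\psi\mid()\mid R\,\mathtt{|}\,R'\mid R\,\mathtt{\&}\,R'\mid R\cdot R'\mid R\{m,n\}\mid\ \sim R\mid\mathtt{(?=}R\mathtt{)}\mid\mathtt{(?<=}R\mathtt{)}\mid\mathtt{(?!}R\mathtt{)}\mid\mathtt{(?<!}R\mathtt{)}$$ with $\psi\in\Psi$ and loop bounds $m,n$ satisfying $0\le m\le n\ne0$ with $n$ finite, or $m\geq 0$ finite and $n=\infty$. Convention: $R\{0,0\}=()$; $R\mathtt{*}$ abbreviates $R\{0,\infty\}$. The last four forms (lookahead, lookback, negative lookahead, negative lookback) are called lookarounds. **Reverse of regexes.** $\psi^r=\psi$, $()^r=()$, $(R|S)^r=R^r|S^r$, $(R\&S)^r=R^r\&S^r$, $(R\cdot S)^r=S^r\cdot R^r$, $(R\{m,n\})^r=R^r\{m,n\}$, $(\sim R)^r=\sim(R^r)$, $\mathtt{(?=}R\mathtt{)}^r=\mathtt{(?<=}R^r\mathtt{)}$, $\mathtt{(?<=}R\mathtt{)}^r=\mathtt{(?=}R^r\mathtt{)}$, $\mathtt{(?!}R\mathtt{)}^r=\mathtt{(?<!}R^r\mathtt{)}$, $\mathtt{(?<!}R\mathtt{)}^r=\mathtt{(?!}R^r\mathtt{)}$. **Nullability, derivatives, match end** (mutually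 recursive). For valid $x$: $\mathit{Null}_x(())$ is true; $\mathit{Null}_x(\psi)$ is false; $\mathit{Null}_x(R|R')$ iff $\mathit{Null}_x(R)$ or $\mathit{Null}_x(R')$; $\mathit{Null}_x(R\&R')$ iff $\mathit{Null}_x(R\cdot R')$ iff $\mathit{Null}_x(R)$ and $\mathit{Null}_x(R')$; $\mathit{Null}_x(R\{m,n\})$ iff $m=0$ or $\mathit{Null}_x(R)$; $\mathit{Null}_x(\sim R)$ iff not $\mathit{Null}_x(R)$; $\mathit{Null}_x(\mathtt{(?=}R\mathtt{)})$ iff $\mathit{IsMatch}(x,R)$; $\mathit{Null}_x(\mathtt{(?<=}R\mathtt{)})$ iff $\mathit{IsMatch}(x^r,R^r)$; $\mathit{Null}_x(\mathtt{(?!}R\mathtt{)})$ iff not $\mathit{IsMatch}(x,R)$; $\mathit{Null}_x(\mathtt{(?<!}R\mathtt{)})$ iff not $\mathit{IsMatch}(x^r,R^r)$. $\mathit{Null}_\forall(R)$ means that $\mathit{Null}_x(R)$ is true for all valid $x$ (in all strings). For valid nonfinal $x=s\langle i\rangle$ the derivative $\partial_x(R)\in\mathcal{R}$ is: $\partial_x(())=\bot$; $\partial_x(\ell)=\bot$ for lookarounds $\ell$; $\partial_{s\langle i\rangle}(\psi)=()$ if $s_i\in[\![\psi]\!]$, else $\bot$; $\partial_x(R|S)=\partial_x(R)|\partial_x(S)$; $\partial_x(R\&S)=\partial_x(R)\&\partial_x(S)$; $\partial_x(\sim R)=\sim\partial_x(R)$; $\partial_x(R\cdot S)=(\partial_x(R)\cdot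 S)\,|\,\partial_x(S)$ if $\mathit{Null}_x(R)$, else $\partial_x(R)\cdot S$; $\partial_x(R\{m,n\})=\partial_x(R)\cdot R\{m\dot-1,n\dot-1\}$ if $m=0$ or $\mathit{Null}_\forall(R)$ or not $\mathit{Null}_x(R)$, else $\partial_x(R\cdot R\{m\dot-1,n\dot-1\})$. Here $\infty\dot-1=\infty$, $0\dot-1=0$, $k\dot-1=k-1$ for $k>0$. $\mathit{Null}^{\mathsf{fail}}_x(R)=x$ if $\mathit{Null}_x(R)$, else $\mathsf{fail}$. $\mathit{MatchEnd}(x,R)=\mathit{Null}^{\mathsf{fail}}_x(R)$ if $x$ is final, else $\max(\mathit{Null}^{\mathsf{fail}}_x(R),\mathit{MatchEnd}(x+1,\partial_x(R)))$. $\mathit{IsMatch}(x,R)$ iff $\mathit{MatchEnd}(x,R)\ne\mathsf{fail}$. **Derivation relation.** For valid $x$, the set of all match ends is $(x\xrightarrow{R})=N_x(R)$ if $x$ is final, else $N_x(R)\cup(x+1\xrightarrow{\partial_x(R)})$, where $N_x(R)=\{x\}$ if $\mathit{Null}_x(R)$ and $\emptyset$ otherwise. Write $x\xrightarrow{R}y$ iff $y\in(x\xrightarrow{R})$. **Top-level match algorithm.** Given $s\in\Sigma^*$ and $R\in\mathcal{R}$, let $x=\mathit{MatchEnd}(s^r\langle0\rangle,\top\mathtt{*}\cdot R^r)$. Then $\mathit{llMatch}(s,R)=\mathsf{fail}$ if $x=\mathsf{fail}$, and otherwise $\mathit{llMatch}(s,R)$ is the pair $\langle x^r,\mathit{MatchEnd}(x^r,R)\rangle$.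 **POSIX match.** The POSIX match for $R$ in $s$, if a match exists, is the pair $\langle s\langle i\rangle,s\langle j\rangle\rangle$ where $s\langle i\rangle$ is the minimal valid location in $s$ such that $\exists y: s\langle i\rangle\xrightarrow{R}y$, and $s\langle j\rangle$ is the maximal location in $s$ such that $s\langle i\rangle\xrightarrow{R}s\langle j\rangle$. *)

theory Defs
  imports Main "HOL-Library.Extended_Nat"
begin

section \<open>Effective Boolean algebras\<close>

text \<open>The domain of characters is the type \<open>'a\<close>, the set of predicates is the type \<open>'p\<close>;
  closure under the connectives is therefore expressed by the types.\<close>

record ('a, 'p) char_alg =
  denote :: "'p \<Rightarrow> 'a set"
  pbot :: 'p
  ptop :: 'p
  pdisj :: "'p \<Rightarrow> 'p \<Rightarrow> 'p"
  pconj :: "'p \<Rightarrow> 'p \<Rightarrow> 'p"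
  pneg :: "'p \<Rightarrow> 'p"

locale effective_boolean_algebra =
  fixes A :: "('a, 'p) char_alg"
  assumes denote_bot: "denote A (pbot A) = {}"
    and denote_top: "denote A (ptop A) = UNIV"
    and denote_disj: "denote A (pdisj A \<phi> \<psi>) = denote A \<phi> \<union> denote A \<psi>"
    and denote_conj: "denote A (pconj A \<phi> \<psi>) = denote A \<phi> \<inter> denote A \<psi>"
    and denote_neg: "denote A (pneg A \<phi>) = UNIV - denote A \<phi>"


section \<open>Locations\<close>

text \<open>Positions are integers because the position \<open>-1\<close> is allowed.\<close>

type_synonym 'a loc = "'a list \<times> int"

definition is_loc :: "'a loc \<Rightarrow> bool" where
  "is_loc x \<longleftrightarrow> - 1 \<le> snd x \<and> snd x \<le> int (length (fst x))"

definition valid_loc :: "'a loc \<Rightarrow> bool" where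
  "valid_loc x \<longleftrightarrow> 0 \<le> snd x \<and> snd x \<le> int (length (fst x))"

definition final_loc :: "'a loc \<Rightarrow> bool" where
  "final_loc x \<longleftrightarrow> snd x = int (length (fst x))"

definition loc_less :: "'a loc \<Rightarrow> 'a loc \<Rightarrow> bool" where
  "loc_less x y \<longleftrightarrow> fst x = fst y \<and> snd x < snd y"

definition loc_succ :: "'a loc \<Rightarrow> 'a loc" where
  "loc_succ x = (fst x, snd x + 1)"

definition loc_rev :: "'a loc \<Rightarrow> 'a loc" where
  "loc_rev x = (rev (fst x), int (length (fst x)) - snd x)"

definition match_fail :: "'a loc" where
  "match_fail = ([], - 1)"

definition loc_max :: "'a loc \<Rightarrow> 'a loc \<Rightarrow> 'a loc" where
  "loc_max x y =
    (if x = match_fail then y else if y = match_fail then x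
     else if loc_less x y then y else x)"

text \<open>The character at a position outside the string is the empty string, which belongs to
  no denotation.\<close>

definition char_at_in :: "'a loc \<Rightarrow> 'a set \<Rightarrow> bool" where
  "char_at_in x C \<longleftrightarrow>
    0 \<le> snd x \<and> snd x < int (length (fst x)) \<and> fst x ! nat (snd x) \<in> C"


section \<open>Regexes\<close>

datatype 'p regex =
    Pred 'p
  | Eps
  | Alt "'p regex" "'p regex"
  | Inter "'p regex" "'p regex"
  | Cat "'p regex" "'p regex"
  | Loop "'p regex" nat enat
  | Compl "'p regex"
  | LookAhead "'p regex"
  | LookBack "'p regex"
  | NegLookAhead "'p regex"
  | NegLookBack "'p regex"

text \<open>The datatype does not restrict loop bounds; the regexes proper are the following ones.\<close>

primrec wf_regex :: "'p regex \<Rightarrow> bool" where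
  "wf_regex (Pred \<psi>) \<longleftrightarrow> True"
| "wf_regex Eps \<longleftrightarrow> True"
| "wf_regex (Alt R S) \<longleftrightarrow> wf_regex R \<and> wf_regex S"
| "wf_regex (Inter R S) \<longleftrightarrow> wf_regex R \<and> wf_regex S"
| "wf_regex (Cat R S) \<longleftrightarrow> wf_regex R \<and> wf_regex S"
| "wf_regex (Loop R m n) \<longleftrightarrow> wf_regex R \<and> enat m \<le> n \<and> n \<noteq> 0"
| "wf_regex (Compl R) \<longleftrightarrow> wf_regex R"
| "wf_regex (LookAhead R) \<longleftrightarrow> wf_regex R"
| "wf_regex (LookBack R) \<longleftrightarrow> wf_regex R"
| "wf_regex (NegLookAhead R) \<longleftrightarrow> wf_regex R"
| "wf_regex (NegLookBack R) \<longleftrightarrow> wf_regex R"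

definition regexes :: "'p regex set" where
  "regexes = {R. wf_regex R}"

text \<open>Loops under the convention \<open>R{0,0} = ()\<close>.\<close>

definition loop :: "'p regex \<Rightarrow> nat \<Rightarrow> enat \<Rightarrow> 'p regex" where
  "loop R m n = (if m = 0 \<and> n = 0 then Eps else Loop R m n)"

definition star :: "'p regex \<Rightarrow> 'p regex" where
  "star R = Loop R 0 \<infinity>"

primrec regex_rev :: "'p regex \<Rightarrow> 'p regex" where
  "regex_rev (Pred \<psi>) = Pred \<psi>"
| "regex_rev Eps = Eps"
| "regex_rev (Alt R S) = Alt (regex_rev R) (regex_rev S)"
| "regex_rev (Inter R S) = Inter (regex_rev R) (regex_rev S)"
| "regex_rev (Cat R S) = Cat (regex_rev S) (regex_rev R)"
| "regex_rev (Loop R m n) = Loop (regex_rev R) m n"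
| "regex_rev (Compl R) = Compl (regex_rev R)"
| "regex_rev (LookAhead R) = LookBack (regex_rev R)"
| "regex_rev (LookBack R) = LookAhead (regex_rev R)"
| "regex_rev (NegLookAhead R) = NegLookBack (regex_rev R)"
| "regex_rev (NegLookBack R) = NegLookAhead (regex_rev R)"


text \<open>These measures serve the termination proof below: the lookaround depth decreases from a lookaround to its body and is not
  increased by derivatives and reversal.\<close>

primrec look_depth :: "'p regex \<Rightarrow> nat" where
  "look_depth (Pred \<psi>) = 0"
| "look_depth Eps = 0"
| "look_depth (Alt R S) = max (look_depth R) (look_depth S)"
| "look_depth (Inter R S) = max (look_depth R) (look_depth S)"
| "look_depth (Cat R S) = max (look_depth R) (look_depth S)"
| "look_depth (Loop R m n) = look_depth R"
| "look_depth (Compl R) = look_depth R"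
| "look_depth (LookAhead R) = Suc (look_depth R)"
| "look_depth (LookBack R) = Suc (look_depth R)"
| "look_depth (NegLookAhead R) = Suc (look_depth R)"
| "look_depth (NegLookBack R) = Suc (look_depth R)"

primrec unfold_size :: "'p regex \<Rightarrow> nat" where
  "unfold_size (Pred \<psi>) = 1"
| "unfold_size Eps = 1"
| "unfold_size (Alt R S) = unfold_size R + unfold_size S + 1"
| "unfold_size (Inter R S) = unfold_size R + unfold_size S + 1"
| "unfold_size (Cat R S) = unfold_size R + unfold_size S + 1"
| "unfold_size (Loop R m n) = (unfold_size R + 2) * (m + 1)"
| "unfold_size (Compl R) = unfold_size R + 1"
| "unfold_size (LookAhead R) = unfold_size R + 1"
| "unfold_size (LookBack R) = unfold_size R + 1"
| "unfold_size (NegLookAhead R) = unfold_size R + 1"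
| "unfold_size (NegLookBack R) = unfold_size R + 1"

lemma look_depth_regex_rev [simp]: "look_depth (regex_rev R) = look_depth R"
  by (induction R) auto

lemma look_depth_loop: "look_depth (loop R m n) \<le> look_depth R"
  by (simp add: loop_def)

lemma unfold_size_loop: "unfold_size (loop R m n) \<le> (unfold_size R + 2) * (m + 1)"
  by (simp add: loop_def)


section \<open>Nullability, derivatives and match ends\<close>

text \<open>The functions are total. Only their values at valid locations (and, for derivatives, at
  valid nonfinal locations) matter; \<open>match_end\<close> and \<open>match_ends\<close> stop at invalid locations so
  that they terminate everywhere.

  The subtraction on \<^typ>\<open>nat\<close> and \<^typ>\<open>enat\<close> is truncated and satisfies \<open>\<infinity> - 1 = \<infinity>\<close>.\<close>

context
  fixes A :: "('a, 'p) char_alg"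
begin

function null :: "'a loc \<Rightarrow> 'p regex \<Rightarrow> bool"
  and null_all :: "'p regex \<Rightarrow> bool"
  and deriv :: "'a loc \<Rightarrow> 'p regex \<Rightarrow> 'p regex"
  and null_fail :: "'a loc \<Rightarrow> 'p regex \<Rightarrow> 'a loc"
  and match_end :: "'a loc \<Rightarrow> 'p regex \<Rightarrow> 'a loc"
  and is_match :: "'a loc \<Rightarrow> 'p regex \<Rightarrow> bool"
where
  "null x (Pred \<psi>) \<longleftrightarrow> False"
| "null x Eps \<longleftrightarrow> True"
| "null x (Alt R S) \<longleftrightarrow> null x R \<or> null x S"
| "null x (Inter R S) \<longleftrightarrow> null x R \<and> null x S"
| "null x (Cat R S) \<longleftrightarrow> null x R \<and> null x S"
| "null x (Loop R m n) \<longleftrightarrow> m = 0 \<or> null x R"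
| "null x (Compl R) \<longleftrightarrow> \<not> null x R"
| "null x (LookAhead R) \<longleftrightarrow> is_match x R"
| "null x (LookBack R) \<longleftrightarrow> is_match (loc_rev x) (regex_rev R)"
| "null x (NegLookAhead R) \<longleftrightarrow> \<not> is_match x R"
| "null x (NegLookBack R) \<longleftrightarrow> \<not> is_match (loc_rev x) (regex_rev R)"
| "null_all R \<longleftrightarrow> (\<forall>x. valid_loc x \<longrightarrow> null x R)"
| "deriv x (Pred \<psi>) = (if char_at_in x (denote A \<psi>) then Eps else Pred (pbot A))"
| "deriv x Eps = Pred (pbot A)"
| "deriv x (Alt R S) = Alt (deriv x R) (deriv x S)"
| "deriv x (Inter R S) = Inter (deriv x R) (deriv x S)"
| "deriv x (Cat R S) =
    (if null x R then Alt (Cat (deriv x R) S) (deriv x S) else Cat (deriv x R) S)"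
| "deriv x (Loop R m n) =
    (if m = 0 \<or> null_all R \<or> \<not> null x R
     then Cat (deriv x R) (loop R (m - 1) (n - 1))
     else deriv x (Cat R (loop R (m - 1) (n - 1))))"
| "deriv x (Compl R) = Compl (deriv x R)"
| "deriv x (LookAhead R) = Pred (pbot A)"
| "deriv x (LookBack R) = Pred (pbot A)"
| "deriv x (NegLookAhead R) = Pred (pbot A)"
| "deriv x (NegLookBack R) = Pred (pbot A)"
| "null_fail x R = (if null x R then x else match_fail)"
| "match_end x R =
    (if final_loc x \<or> \<not> valid_loc x then null_fail x R
     else loc_max (null_fail x R) (match_end (loc_succ x) (deriv x R)))"
| "is_match x R \<longleftrightarrow> match_end x R \<noteq> match_fail"
  by pat_completeness auto

lemma look_depth_deriv_partial:
  "null_null_all_deriv_null_fail_match_end_is_match_dom (Inl (Inr (Inr (x, R)))) \<Longrightarrow>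
    look_depth (deriv x R) \<le> look_depth R"
proof (induction rule: null_null_all_deriv_null_fail_match_end_is_match.pinduct(3)
    [where ?P1.0 = "\<lambda>_ _. True" and ?P2.0 = "\<lambda>_. True" and ?P4.0 = "\<lambda>_ _. True"
      and ?P5.0 = "\<lambda>_ _. True" and ?P6.0 = "\<lambda>_ _. True"])
  case (18 x R m n)
  then show ?case
    using look_depth_loop[of R "m - 1" "n - 1"] by (auto simp: deriv.psimps)
qed (auto simp: deriv.psimps)

termination
proof (relation "inv_image (less_than <*lex*> less_than <*lex*> less_than) (\<lambda>a. case a of
      Inl (Inl (x, R)) \<Rightarrow> (look_depth R, 0, 2 * unfold_size R)
    | Inl (Inr (Inl R)) \<Rightarrow> (look_depth R, 0, 2 * unfold_size R + 1)
    | Inl (Inr (Inr (x, R))) \<Rightarrow> (look_depth R, 0, 2 * unfold_size R + 1)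
    | Inr (Inl (x, R)) \<Rightarrow> (look_depth R, 0, 2 * unfold_size R + 1)
    | Inr (Inr (Inl (x, R))) \<Rightarrow> (look_depth R, Suc (nat (int (length (fst x)) - snd x)), 0)
    | Inr (Inr (Inr (x, R))) \<Rightarrow> (look_depth R, Suc (nat (int (length (fst x)) - snd x)), 1))",
    goal_cases)
  case (26 x R m n)
  then have "m \<noteq> 0"
    by simp
  then have "unfold_size (Cat R (loop R (m - 1) (n - 1))) < unfold_size (Loop R m n)"
    using unfold_size_loop[of R "m - 1" "n - 1"] by (cases m) auto
  moreover have "look_depth (Cat R (loop R (m - 1) (n - 1))) \<le> look_depth (Loop R m n)"
    using look_depth_loop[of R "m - 1" "n - 1"] by simp
  ultimately show ?case
    by auto
qed (auto simp: final_loc_def valid_loc_def loc_succ_def max_def dest!: look_depth_deriv_partial)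

declare null_all.simps [simp del] match_end.simps [simp del]

definition null_locs :: "'a loc \<Rightarrow> 'p regex \<Rightarrow> 'a loc set" where
  "null_locs x R = (if null x R then {x} else {})"

function match_ends :: "'a loc \<Rightarrow> 'p regex \<Rightarrow> 'a loc set" where
  "match_ends x R =
    (if final_loc x \<or> \<not> valid_loc x then null_locs x R
     else null_locs x R \<union> match_ends (loc_succ x) (deriv x R))"
  by pat_completeness auto
termination
  by (relation "measure (\<lambda>(x, R). nat (int (length (fst x)) - snd x))")
    (auto simp: final_loc_def valid_loc_def loc_succ_def)

declare match_ends.simps [simp del]

definition derives :: "'a loc \<Rightarrow> 'p regex \<Rightarrow> 'a loc \<Rightarrow> bool" where
  "derives x R y \<longleftrightarrow> y \<in> match_ends x R"

lemma wf_regex_deriv: "wf_regex R \<Longrightarrow> wf_regex (deriv x R)"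
proof (induction x R rule: null_null_all_deriv_null_fail_match_end_is_match.induct(3)
    [where ?P1.0 = "\<lambda>_ _. True" and ?P2.0 = "\<lambda>_. True" and ?P4.0 = "\<lambda>_ _. True"
      and ?P5.0 = "\<lambda>_ _. True" and ?P6.0 = "\<lambda>_ _. True"])
  case (18 x R m n)
  then have "wf_regex (loop R (m - 1) (n - 1))"
    by (cases n) (auto simp: loop_def one_enat_def zero_enat_def)
  with 18 show ?case
    by auto
qed auto


section \<open>Matches\<close>

text \<open>The overall failure of the match algorithm is \<^const>\<open>None\<close>.\<close>

definition ll_match :: "'a list \<Rightarrow> 'p regex \<Rightarrow> ('a loc \<times> 'a loc) option" where
  "ll_match s R =
    (let x = match_end (rev s, 0) (Cat (star (Pred (ptop A))) (regex_rev R))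
     in if x = match_fail then None else Some (loc_rev x, match_end (loc_rev x) R))"

definition is_posix_match :: "'a list \<Rightarrow> 'p regex \<Rightarrow> 'a loc \<times> 'a loc \<Rightarrow> bool" where
  "is_posix_match s R p \<longleftrightarrow>
    (\<exists>i j. p = ((s, i), (s, j)) \<and>
      valid_loc (s, i) \<and> (\<exists>y. derives (s, i) R y) \<and>
      (\<forall>k. valid_loc (s, k) \<and> (\<exists>y. derives (s, k) R y) \<longrightarrow> i \<le> k) \<and>
      is_loc (s, j) \<and> derives (s, i) R (s, j) \<and>
      (\<forall>k. is_loc (s, k) \<and> derives (s, i) R (s, k) \<longrightarrow> k \<le> j))"

end

end

theory Submission
  imports Defs
begin

text \<open>Read every regex as a binary relation on valid locations. The derivation relation then turns
  out to be compositional: alternation is union, concatenation is relational composition, and a loop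
  is a union of relational powers. In this reading reversal of regexes is conversion of relations
  along reversal of locations. Since \<^term>\<open>match_end\<close> computes the greatest location related
  to its argument, running it on the reversed string with \<open>\<top>*\<close> in front finds the greatest end of
  a reversed match, that is, the least start of a match.\<close>

declare split_paired_All [simp del] split_paired_Ex [simp del]

section \<open>Locations: reversal, order and induction\<close>

lemma valid_loc_rev [simp]: "valid_loc (loc_rev x) \<longleftrightarrow> valid_loc x"
  by (auto simp: valid_loc_def loc_rev_def)

lemma loc_rev_rev [simp]: "loc_rev (loc_rev x) = x"
  by (cases x) (simp add: loc_rev_def)

lemma loc_rev_eq_iff: "loc_rev x = loc_rev y \<longleftrightarrow> x = y"
  by (metis loc_rev_rev)

lemma regex_rev_rev [simp]: "regex_rev (regex_rev R) = R"
  by (induction R) auto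

lemma regex_rev_loop [simp]: "regex_rev (loop R m n) = loop (regex_rev R) m n"
  by (simp add: loop_def)

lemma valid_loc_succ: "valid_loc x \<Longrightarrow> \<not> final_loc x \<Longrightarrow> valid_loc (loc_succ x)"
  by (auto simp: valid_loc_def final_loc_def loc_succ_def)

lemma loc_less_succ [simp]: "loc_less x (loc_succ x)"
  by (simp add: loc_less_def loc_succ_def)

lemma loc_less_of_succ: "loc_succ x = y \<or> loc_less (loc_succ x) y \<Longrightarrow> loc_less x y"
  by (auto simp: loc_less_def loc_succ_def)

lemma loc_less_irrefl [simp]: "\<not> loc_less x x"
  by (simp add: loc_less_def)

lemma loc_less_trans: "loc_less x y \<Longrightarrow> loc_less y z \<Longrightarrow> loc_less x z"
  by (auto simp: loc_less_def)

text \<open>The distance to the end of the string decreases. The hypothesis covers all later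
  locations and not just the successor, because the first iteration of a loop may end at any of
  them.\<close>

lemma valid_loc_induct [consumes 1, case_names later]:
  assumes "valid_loc x"
    and step: "\<And>x. valid_loc x \<Longrightarrow> (\<And>z. loc_less x z \<Longrightarrow> valid_loc z \<Longrightarrow> P z) \<Longrightarrow> P x"
  shows "P x"
  using assms(1)
proof (induction "nat (int (length (fst x)) - snd x)" arbitrary: x rule: less_induct)
  case less
  show ?case
    by (rule step[OF less.prems], rule less.hyps) (auto simp: loc_less_def valid_loc_def)
qed

lemma match_fail_not_valid [simp]: "\<not> valid_loc match_fail"
  by (simp add: match_fail_def valid_loc_def)

text \<open>Removing the last factor of a \<open>P\<close>-path removes the first factor of its
  image under \<open>f\<close>. With \<open>f\<close> as reversal of locations this handles loops in
  \<open>reach_rev\<close>.\<close>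

lemma relpowp_anti_hom:
  assumes "\<And>x. f (f x) = x" and "\<And>x y. Q (f y) (f x) \<longleftrightarrow> P x y"
  shows "(Q ^^ k) (f y) (f x) \<longleftrightarrow> (P ^^ k) x y"
proof (induction k arbitrary: x y)
  case 0
  then show ?case
    using assms(1) by (metis relpowp_0_E relpowp_0_I)
next
  case (Suc k)
  have "(Q ^^ Suc k) (f y) (f x) \<longleftrightarrow> (\<exists>z. Q (f y) z \<and> (Q ^^ k) z (f x))"
    by (metis relpowp_Suc_D2 relpowp_Suc_I2)
  also have "\<dots> \<longleftrightarrow> (\<exists>z. Q (f y) (f z) \<and> (Q ^^ k) (f z) (f x))"
    using assms(1) by metis
  also have "\<dots> \<longleftrightarrow> (P ^^ Suc k) x y"
    by (auto simp: Suc assms(2))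
  finally show ?case .
qed

section \<open>The derivation relation on valid locations\<close>

context effective_boolean_algebra
begin

text \<open>Validity of the start is built in because \<open>match_ends\<close> still returns
  \<open>null_locs\<close> at an invalid location.\<close>

definition reach :: "'p regex \<Rightarrow> 'a loc \<Rightarrow> 'a loc \<Rightarrow> bool" where
  "reach R x y \<longleftrightarrow> valid_loc x \<and> derives A x R y"

lemma reach_unfold:
  "reach R x y \<longleftrightarrow> valid_loc x \<and>
    ((null A x R \<and> y = x) \<or> (\<not> final_loc x \<and> reach (deriv A x R) (loc_succ x) y))"
  unfolding reach_def derives_def
  by (subst match_ends.simps) (auto simp: null_locs_def valid_loc_succ)

lemma reach_ordered:
  "reach R x y \<Longrightarrow> valid_loc x \<and> valid_loc y \<and> (x = y \<or> loc_less x y)"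
proof -
  have "valid_loc x \<Longrightarrow> reach R x y \<Longrightarrow> valid_loc y \<and> (x = y \<or> loc_less x y)"
  proof (induction x arbitrary: R rule: valid_loc_induct)
    case (later x)
    show ?case
      using later.prems later.IH[of "loc_succ x" "deriv A x R"] reach_unfold[of R x y]
        valid_loc_succ[OF later.hyps] loc_less_of_succ[of x y]
      by auto
  qed
  then show "reach R x y \<Longrightarrow> ?thesis"
    by (auto simp: reach_def)
qed

text \<open>Matches of the derivative start at \<open>loc_succ x\<close> and never move back, so
  only nullability relates \<open>x\<close> to itself.\<close>

lemma reach_refl_iff: "reach R x x \<longleftrightarrow> valid_loc x \<and> null A x R"
  using reach_unfold[of R x x] reach_ordered[of "deriv A x R" "loc_succ x" x]
    loc_less_of_succ[of x x]
  by auto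

lemma reach_deriv_ordered: "reach (deriv A x R) (loc_succ x) y \<Longrightarrow> loc_less x y \<and> valid_loc y"
  using reach_ordered[of "deriv A x R" "loc_succ x" y] loc_less_of_succ[of x y] by auto

text \<open>Together with \<open>reach_refl_iff\<close> this separates the empty match from the
  nonempty ones. Intersection and complement need the separation, since they do not distribute over
  the disjunction in \<open>reach_unfold\<close>.\<close>

lemma reach_irrefl_iff:
  assumes "valid_loc x" and "y \<noteq> x"
  shows "reach R x y \<longleftrightarrow> \<not> final_loc x \<and> reach (deriv A x R) (loc_succ x) y"
  using assms reach_unfold[of R x y] by auto

section \<open>Relational laws for the regex constructors other than loops\<close>

lemma not_reach_bot [simp]: "\<not> reach (Pred (pbot A)) x y"
proof -
  have "valid_loc x \<Longrightarrow> \<not> reach (Pred (pbot A)) x y"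
  proof (induction x rule: valid_loc_induct)
    case (later x)
    show ?case
      using later.IH[of "loc_succ x"] valid_loc_succ[of x] later.hyps
      by (subst reach_unfold) (auto simp: char_at_in_def denote_bot)
  qed
  then show ?thesis
    by (auto simp: reach_def)
qed

lemma reach_Eps [simp]: "reach Eps x y \<longleftrightarrow> valid_loc x \<and> y = x"
  by (subst reach_unfold) auto

lemma reach_Pred: "reach (Pred \<psi>) x y \<longleftrightarrow> char_at_in x (denote A \<psi>) \<and> y = loc_succ x"
  by (subst reach_unfold) (auto simp: char_at_in_def valid_loc_def final_loc_def loc_succ_def)

text \<open>Serves all four lookarounds, whose derivative is bottom.\<close>

lemma reach_look:
  assumes "deriv A x R = Pred (pbot A)"
  shows "reach R x y \<longleftrightarrow> valid_loc x \<and> null A x R \<and> y = x"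
  using assms by (subst reach_unfold) auto

lemma reach_Alt: "reach (Alt R S) x y \<longleftrightarrow> reach R x y \<or> reach S x y"
proof -
  have "valid_loc x \<Longrightarrow> ?thesis"
  proof (induction x arbitrary: R S rule: valid_loc_induct)
    case (later x)
    show ?case
      using later.IH[of "loc_succ x" "deriv A x R" "deriv A x S"] valid_loc_succ[of x] later.hyps
        reach_unfold[of R x y] reach_unfold[of S x y] reach_unfold[of "Alt R S" x y]
      by auto
  qed
  then show ?thesis
    by (auto simp: reach_def)
qed

lemma reach_Inter: "reach (Inter R S) x y \<longleftrightarrow> reach R x y \<and> reach S x y"
proof -
  have "valid_loc x \<Longrightarrow> ?thesis"
  proof (induction x arbitrary: R S rule: valid_loc_induct)
    case (later x)
    show ?case
    proof (cases "y = x")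
      case True
      then show ?thesis
        by (auto simp: reach_refl_iff)
    next
      case False
      then show ?thesis
        using later.IH[of "loc_succ x" "deriv A x R" "deriv A x S"] valid_loc_succ[of x] later.hyps
        by (auto simp: reach_irrefl_iff)
    qed
  qed
  then show ?thesis
    by (auto simp: reach_def)
qed

text \<open>The complement is relative to the upper bound that \<open>reach_ordered\<close> puts on
  every relation \<open>reach R\<close>.\<close>

lemma reach_Compl:
  "reach (Compl R) x y \<longleftrightarrow>
    valid_loc x \<and> valid_loc y \<and> (x = y \<or> loc_less x y) \<and> \<not> reach R x y"
proof -
  have "valid_loc x \<Longrightarrow> ?thesis"
  proof (induction x arbitrary: R rule: valid_loc_induct)
    case (later x)
    show ?case
    proof (cases "y = x")
      case True
      then show ?thesis
        using later.hyps by (auto simp: reach_refl_iff)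
    next
      case False
      \<comment> \<open>Ordered pairs obey the same recursion as nonempty matches, so negation
        passes through the derivative.\<close>
      have "valid_loc y \<Longrightarrow> loc_less x y \<Longrightarrow>
          \<not> final_loc x \<and> (loc_succ x = y \<or> loc_less (loc_succ x) y)"
        by (cases x; cases y) (auto simp: loc_less_def loc_succ_def final_loc_def valid_loc_def)
      moreover note loc_less_of_succ[of x y]
      ultimately show ?thesis
        using later.IH[of "loc_succ x" "deriv A x R"] valid_loc_succ[of x] later.hyps False
        by (auto simp: reach_irrefl_iff)
    qed
  qed
  then show ?thesis
    by (auto simp: reach_def)
qed

lemma reach_Cat: "reach (Cat R S) x y \<longleftrightarrow> (\<exists>z. reach R x z \<and> reach S z y)"
proof -
  have "valid_loc x \<Longrightarrow> ?thesis"
  proof (induction x arbitrary: R S rule: valid_loc_induct)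
    case (later x)
    have null_both: "null A x (Cat R S) \<longleftrightarrow> null A x R \<and> null A x S"
      by simp
    \<comment> \<open>The last disjunct is the intermediate location \<open>z = x\<close>, where
      \<open>S\<close> consumes the first character. The match that is empty in both factors is
      added by unfolding \<open>S\<close> at \<open>x\<close>.\<close>
    have "reach (deriv A x (Cat R S)) (loc_succ x) y \<longleftrightarrow>
        (\<exists>z. reach (deriv A x R) (loc_succ x) z \<and> reach S z y) \<or>
        null A x R \<and> reach (deriv A x S) (loc_succ x) y" if "\<not> final_loc x"
      using later.IH[of "loc_succ x" "deriv A x R" S] valid_loc_succ[OF later.hyps that]
      by (auto simp: reach_Alt)
    then have "reach (Cat R S) x y \<longleftrightarrow> null A x R \<and> reach S x y \<or>
        \<not> final_loc x \<and> (\<exists>z. reach (deriv A x R) (loc_succ x) z \<and> reach S z y)"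
      using reach_unfold[of "Cat R S" x y] reach_unfold[of S x y] later.hyps null_both by blast
    then show ?case
      using reach_unfold[of R x] later.hyps by auto
  qed
  then show ?thesis
    by (auto simp: reach_def)
qed

section \<open>Relational powers and loops\<close>

lemma relpowp_reach_ordered:
  "(reach R ^^ k) x y \<Longrightarrow> valid_loc x \<Longrightarrow> valid_loc y \<and> (x = y \<or> loc_less x y)"
proof (induction k arbitrary: y)
  case (Suc k)
  then obtain z where "(reach R ^^ k) x z" "reach R z y"
    by auto
  with Suc.IH[of z] Suc.prems show ?case
    using reach_ordered[of R z y] loc_less_trans[of x z y] by auto
qed auto

lemma relpowp_reach_refl:
  assumes "valid_loc x" and "null A x R"
  shows "(reach R ^^ k) x x"
  using assms by (induction k) (auto simp: reach_refl_iff)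

text \<open>Steps never go back, so on a path from \<open>x\<close> to \<open>x\<close> the first
  iteration already ends at \<open>x\<close>.\<close>

lemma relpowp_reach_refl_iff:
  assumes "valid_loc x"
  shows "(reach R ^^ k) x x \<longleftrightarrow> k = 0 \<or> null A x R"
proof (cases k)
  case (Suc l)
  have "null A x R" if pow: "(reach R ^^ Suc l) x x"
  proof -
    obtain z where z: "reach R x z" "(reach R ^^ l) z x"
      using relpowp_Suc_D2[OF pow] by blast
    then have "z = x"
      using reach_ordered relpowp_reach_ordered loc_less_trans loc_less_irrefl by metis
    with z show ?thesis
      by (simp add: reach_refl_iff)
  qed
  then show ?thesis
    using Suc assms relpowp_reach_refl by blast
qed auto

text \<open>The missing iterations are appended as empty ones at \<open>y\<close>. With lookarounds,
  nullability at \<open>x\<close> says nothing about \<open>y\<close>, hence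
  \<open>null_all\<close>.\<close>

lemma relpowp_reach_mono:
  assumes "null_all A R" and "valid_loc x" and "(reach R ^^ k) x y" and "k \<le> l"
  shows "(reach R ^^ l) x y"
proof -
  have "valid_loc y"
    using relpowp_reach_ordered assms by blast
  then have "(reach R ^^ (l - k)) y y"
    using assms(1) relpowp_reach_refl by (simp add: null_all.simps)
  then have "(reach R ^^ (k + (l - k))) x y"
    using assms(3) by (metis relpowp_trans)
  with assms(4) show ?thesis
    by simp
qed

text \<open>Iterations that match the empty string at the start can be dropped, so a nonempty match
  begins with a nonempty iteration.\<close>

lemma relpowp_reach_nonempty:
  assumes "(reach R ^^ k) x y" and "y \<noteq> x"
  obtains z l where "reach R x z" "z \<noteq> x" "(reach R ^^ l) z y" "l < k"
proof -
  have "\<exists>z l. reach R x z \<and> z \<noteq> x \<and> (reach R ^^ l) z y \<and> l < k"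
    using assms
  proof (induction k)
    case (Suc k)
    then obtain z where z: "reach R x z" "(reach R ^^ k) z y"
      by (metis relpowp_Suc_D2)
    show ?case
    proof (cases "z = x")
      case True
      with z Suc show ?thesis
        using less_SucI by blast
    qed (use z in blast)
  qed auto
  with that show ?thesis
    by blast
qed

text \<open>The outer induction on the location handles the rest of the loop after a nonempty first
  iteration. The inner induction on \<open>m\<close> handles the derivative rule that unfolds the
  loop to a concatenation, where the rest may start at \<open>x\<close> itself. Stating the law for
  \<open>loop\<close> includes the bounds 0,0 that decrementing produces.\<close>

lemma reach_loop:
  assumes "enat m \<le> n"
  shows "reach (loop R m n) x y \<longleftrightarrow>
    valid_loc x \<and> (\<exists>k\<ge>m. enat k \<le> n \<and> (reach R ^^ k) x y)"
proof -
  have "valid_loc x \<Longrightarrow> enat m \<le> n \<Longrightarrow>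
    reach (loop R m n) x y \<longleftrightarrow> (\<exists>k\<ge>m. enat k \<le> n \<and> (reach R ^^ k) x y)"
  proof (induction x arbitrary: m n rule: valid_loc_induct)
    case (later x)
    note IH = later.IH and x = later.hyps
    from later.prems show ?case
    proof (induction m arbitrary: n rule: less_induct)
      case (less m)
      show ?case
      proof (cases "n = 0")
        case True
        with less.prems have "m = 0"
          by (simp add: zero_enat_def)
        with True show ?thesis
          using x by (auto simp: loop_def zero_enat_def)
      next
        case n: False
        then have loop: "loop R m n = Loop R m n"
          by (simp add: loop_def)
        define L where "L = loop R (m - 1) (n - 1)"
        have le: "enat (m - 1) \<le> n - 1"
          using less.prems by (cases n) (auto simp: one_enat_def)
        have Suc_le: "enat (Suc k) \<le> n \<longleftrightarrow> enat k \<le> n - 1" for k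
          using n by (cases n) (auto simp: one_enat_def zero_enat_def)
        \<comment> \<open>The outer hypothesis applies because \<open>z\<close> lies strictly after
          \<open>x\<close>.\<close>
        have L: "reach L z y \<longleftrightarrow> (\<exists>k\<ge>m - 1. enat k \<le> n - 1 \<and> (reach R ^^ k) z y)"
          if "reach R x z" "z \<noteq> x" for z
          unfolding L_def using IH[of z "m - 1" "n - 1"] le that reach_ordered[of R x z] by auto
        show ?thesis
        proof (cases "y = x")
          case True
          then show ?thesis
            using x less.prems
            by (auto simp: loop reach_refl_iff relpowp_reach_refl_iff)
        next
          case y: False
          \<comment> \<open>Differentiating \<open>R\<close> and keeping \<open>L\<close> describes
            exactly a nonempty first iteration.\<close>
          have step: "reach (Cat (deriv A x R) L) (loc_succ x) y \<and> \<not> final_loc x \<longleftrightarrow>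
              (\<exists>z. reach R x z \<and> z \<noteq> x \<and>
                (\<exists>k\<ge>m - 1. enat k \<le> n - 1 \<and> (reach R ^^ k) z y))"
          proof -
            have "reach (Cat (deriv A x R) L) (loc_succ x) y \<and> \<not> final_loc x \<longleftrightarrow>
              (\<exists>z. reach R x z \<and> z \<noteq> x \<and> reach L z y)"
              unfolding reach_Cat
              using reach_irrefl_iff[OF x] reach_deriv_ordered[of x R] loc_less_irrefl
              by metis
            then show ?thesis
              using L by blast
          qed
          have sound: "\<exists>k\<ge>m. enat k \<le> n \<and> (reach R ^^ k) x y"
            if "reach R x z" "(reach R ^^ k) z y" "k \<ge> m - 1" "enat k \<le> n - 1" for z k
            using that Suc_le[of k] relpowp_Suc_I2[of "reach R" x z k y]
            by (intro exI[of _ "Suc k"]) auto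
          have Loop: "reach (Loop R m n) x y \<longleftrightarrow>
              \<not> final_loc x \<and> reach (deriv A x (Loop R m n)) (loc_succ x) y"
            using reach_irrefl_iff[OF x y] .
          show ?thesis
          proof (cases "m = 0 \<or> null_all A R \<or> \<not> null A x R")
            case True
            then have Loop': "reach (Loop R m n) x y \<longleftrightarrow>
                reach (Cat (deriv A x R) L) (loc_succ x) y \<and> \<not> final_loc x"
              using Loop by (auto simp: L_def)
            \<comment> \<open>The first iteration can be made nonempty. It is so already if
              \<open>R\<close> is not nullable at \<open>x\<close>. Otherwise leading empty
              iterations are dropped: for \<open>m = 0\<close> the smaller count is still allowed,
              and under \<open>null_all\<close> the count is padded back up to
              \<open>k'\<close>.\<close>
            have "\<exists>z. reach R x z \<and> z \<noteq> x \<and>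
                (\<exists>k\<ge>m - 1. enat k \<le> n - 1 \<and> (reach R ^^ k) z y)"
              if k: "k \<ge> m" "enat k \<le> n" "(reach R ^^ k) x y" for k
            proof -
              have "k \<noteq> 0"
                using k y by (auto intro: ccontr)
              then obtain k' where k': "k = Suc k'"
                by (cases k) auto
              have le': "enat k' \<le> n - 1"
                using Suc_le k k' by simp
              show ?thesis
              proof (cases "null A x R")
                case False
                obtain z where z: "reach R x z" "(reach R ^^ k') z y"
                  using k k' by (metis relpowp_Suc_D2)
                with False have "z \<noteq> x"
                  by (auto simp: reach_refl_iff)
                with z k k' le' show ?thesis
                  by (intro exI[of _ z] conjI exI[of _ k']) auto
              next
                case null: True
                obtain z l where z: "reach R x z" "z \<noteq> x" "(reach R ^^ l) z y" "l < k"
                  using relpowp_reach_nonempty[OF k(3) y] .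
                have l: "enat l \<le> n - 1"
                  using z(4) k' le' by (meson enat_ord_simps(1) less_Suc_eq_le order_trans)
                show ?thesis
                proof (cases "m = 0")
                  case True
                  then show ?thesis
                    using z l by auto
                next
                  case False
                  then have "(reach R ^^ k') z y"
                    using True null z k' reach_ordered[of R x z]
                      relpowp_reach_mono[of R z l y k'] by auto
                  with z k k' le' show ?thesis
                    by (intro exI[of _ z] conjI exI[of _ k']) auto
                qed
              qed
            qed
            then show ?thesis
              unfolding loop Loop' step using sound by blast
          next
            case False
            then have m: "m - 1 < m" and null: "null A x R"
              by auto
            \<comment> \<open>Here dropped empty iterations might not be restorable later, so the
              derivative of the concatenation keeps both options: a nonempty first iteration, or an
              empty one followed by \<open>L\<close> at \<open>x\<close>. The inner hypothesis
              interprets the latter.\<close>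
            have "reach (Loop R m n) x y \<longleftrightarrow>
                (reach (Cat (deriv A x R) L) (loc_succ x) y \<and> \<not> final_loc x) \<or> reach L x y"
              using Loop False reach_irrefl_iff[OF x y, of L] by (auto simp: L_def reach_Alt)
            also have "\<dots> \<longleftrightarrow> (\<exists>z. reach R x z \<and>
                (\<exists>k\<ge>m - 1. enat k \<le> n - 1 \<and> (reach R ^^ k) z y))"
              unfolding step using less.IH[OF m le] null x reach_refl_iff[of R x]
              by (auto simp: L_def)
            also have "\<dots> \<longleftrightarrow> (\<exists>k\<ge>m. enat k \<le> n \<and> (reach R ^^ k) x y)"
            proof
              assume "\<exists>k\<ge>m. enat k \<le> n \<and> (reach R ^^ k) x y"
              then obtain k where k: "k \<ge> m" "enat k \<le> n" "(reach R ^^ k) x y"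
                by blast
              with m obtain k' where k': "k = Suc k'"
                by (cases k) auto
              obtain z where "reach R x z" "(reach R ^^ k') z y"
                using k k' by (metis relpowp_Suc_D2)
              then show "\<exists>z. reach R x z \<and>
                  (\<exists>k\<ge>m - 1. enat k \<le> n - 1 \<and> (reach R ^^ k) z y)"
                using k k' Suc_le by (intro exI[of _ z] conjI exI[of _ k']) auto
            qed (use sound in blast)
            finally show ?thesis
              unfolding loop .
          qed
        qed
      qed
    qed
  qed
  then show ?thesis
    using assms by (auto simp: reach_def)
qed

section \<open>The search prefix and reversal\<close>

lemma reach_star_top:
  "reach (star (Pred (ptop A))) x y \<longleftrightarrow> valid_loc x \<and> valid_loc y \<and> (x = y \<or> loc_less x y)"
proof -
  have star: "star (Pred (ptop A)) = loop (Pred (ptop A)) 0 \<infinity>"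
    by (simp add: star_def loop_def)
  \<comment> \<open>Each iteration consumes exactly one arbitrary character, so the number of
    iterations is the distance covered.\<close>
  have powers: "(reach (Pred (ptop A)) ^^ k) x (fst x, snd x + int k)"
    if "0 \<le> snd x" "snd x + int k \<le> int (length (fst x))" for k
    using that
    by (induction k) (auto simp: reach_Pred char_at_in_def denote_top loc_succ_def intro!: relcomppI)
  have "\<exists>k. (reach (Pred (ptop A)) ^^ k) x y"
    if "valid_loc x" "valid_loc y" "x = y \<or> loc_less x y"
  proof -
    have "y = (fst x, snd x + int (nat (snd y - snd x)))"
      using that by (cases y) (auto simp: loc_less_def)
    with powers[of "nat (snd y - snd x)"] that show ?thesis
      by (metis snd_conv fst_conv valid_loc_def)
  qed
  then show ?thesis
    unfolding star using relpowp_reach_ordered[of _ "Pred (ptop A)" x y]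
    by (auto simp: reach_loop zero_enat_def[symmetric])
qed

text \<open>Structural induction with the relational laws. Lookarounds follow from the definition of
  \<open>null\<close>, as lookback is lookahead at the reversed location with the reversed body and
  both reversals are involutions. Well-formedness supplies the loop bounds for
  \<open>reach_loop\<close>.\<close>

lemma reach_rev:
  assumes "wf_regex R"
  shows "reach (regex_rev R) (loc_rev y) (loc_rev x) \<longleftrightarrow> reach R x y"
  using assms
proof (induction R arbitrary: x y)
  case (Pred \<psi>)
  have "(loc_rev x = loc_succ (loc_rev y)) \<longleftrightarrow> y = loc_succ x"
    by (cases x; cases y) (auto simp: loc_rev_def loc_succ_def)
  \<comment> \<open>The shift by one matters: the character just after \<open>x\<close> is the one
    just after the reversal of \<open>loc_succ x\<close>.\<close>
  moreover have "char_at_in (loc_rev (loc_succ x)) C \<longleftrightarrow> char_at_in x C" for C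
    by (cases x)
      (auto simp: char_at_in_def loc_rev_def loc_succ_def rev_nth nat_diff_distrib nat_add_distrib
        algebra_simps)
  ultimately show ?case
    by (auto simp: reach_Pred)
next
  case (Cat R S)
  have "reach (regex_rev (Cat R S)) (loc_rev y) (loc_rev x) \<longleftrightarrow>
      (\<exists>z. reach (regex_rev S) (loc_rev y) (loc_rev z) \<and>
        reach (regex_rev R) (loc_rev z) (loc_rev x))"
    by (simp add: reach_Cat) (metis loc_rev_rev)
  with Cat show ?case
    by (auto simp: reach_Cat)
next
  case (Loop R m n)
  have loop: "Loop R m n = loop R m n"
    using Loop.prems by (simp add: loop_def)
  have pow: "(reach (regex_rev R) ^^ k) (loc_rev y) (loc_rev x) \<longleftrightarrow> (reach R ^^ k) x y" for k
    using Loop by (intro relpowp_anti_hom) auto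
  \<comment> \<open>\<open>reach_loop\<close> asks for validity of the start, which is
    \<open>x\<close> on one side and the reversal of \<open>y\<close> on the other.\<close>
  have "(reach R ^^ k) x y \<Longrightarrow> valid_loc x \<longleftrightarrow> valid_loc y" for k
    using relpowp_reach_ordered[of k R x y]
      relpowp_reach_ordered[of k "regex_rev R" "loc_rev y" "loc_rev x"] pow[of k] by auto
  then show ?case
    unfolding loop using Loop.prems by (auto simp: reach_loop pow)
next
  case (Compl R)
  have "loc_rev y = loc_rev x \<or> loc_less (loc_rev y) (loc_rev x) \<longleftrightarrow> x = y \<or> loc_less x y"
    by (cases x; cases y) (auto simp: loc_less_def loc_rev_def)
  with Compl show ?case
    by (auto simp: reach_Compl)
qed (auto simp: reach_Alt reach_Inter reach_look loc_rev_eq_iff)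

section \<open>Greatest match ends\<close>

lemma match_end_greatest:
  assumes "valid_loc x"
  shows "if \<exists>y. reach R x y
    then reach R x (match_end A x R) \<and> (\<forall>y. reach R x y \<longrightarrow> snd y \<le> snd (match_end A x R))
    else match_end A x R = match_fail"
  using assms
proof (induction x arbitrary: R rule: valid_loc_induct)
  case (later x)
  have fail: "x \<noteq> match_fail"
    using later.hyps by auto
  show ?case
  proof (cases "final_loc x")
    case True
    then show ?thesis
      using later.hyps reach_unfold[of R x] by (auto simp: match_end.simps)
  next
    case False
    define e where "e = match_end A (loc_succ x) (deriv A x R)"
    have unfold: "reach R x y \<longleftrightarrow>
        null A x R \<and> y = x \<or> reach (deriv A x R) (loc_succ x) y" for y
      using later.hyps False reach_unfold[of R x y] by auto
    have "match_end A x R = loc_max (null_fail A x R) e"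
      using False later.hyps by (simp add: match_end.simps[of A x R] e_def)
    moreover have "if \<exists>y. reach (deriv A x R) (loc_succ x) y
      then reach (deriv A x R) (loc_succ x) e \<and>
        (\<forall>y. reach (deriv A x R) (loc_succ x) y \<longrightarrow> snd y \<le> snd e)
      else e = match_fail"
      unfolding e_def using later.IH[OF loc_less_succ valid_loc_succ[OF later.hyps False]] .
    \<comment> \<open>An end found later exceeds \<open>x\<close> and is not the failure value, so
      \<open>loc_max\<close> selects it even if \<open>x\<close> is itself a match end.\<close>
    moreover have "loc_less x e \<and> e \<noteq> match_fail" if "reach (deriv A x R) (loc_succ x) e"
      using reach_deriv_ordered[OF that] by auto
    ultimately show ?thesis
      unfolding unfold using fail
      by (cases "\<exists>y. reach (deriv A x R) (loc_succ x) y")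
        (auto simp: loc_max_def loc_less_def)
  qed
qed

text \<open>Match ends are valid and \<open>match_fail\<close> is not, so success is never mistaken
  for failure.\<close>

lemma match_end_eq_fail_iff:
  assumes "valid_loc x"
  shows "match_end A x R = match_fail \<longleftrightarrow> \<not> (\<exists>y. reach R x y)"
proof -
  have "\<not> reach R x match_fail"
    using reach_ordered[of R x match_fail] by auto
  then show ?thesis
    using match_end_greatest[OF assms, of R] by metis
qed

lemma reach_match_end:
  assumes "reach R x y"
  shows "reach R x (match_end A x R)" and "snd y \<le> snd (match_end A x R)"
proof -
  have "valid_loc x"
    using assms by (simp add: reach_def)
  from match_end_greatest[OF this, of R] assms
  show "reach R x (match_end A x R)" and "snd y \<le> snd (match_end A x R)"
    by (auto split: if_splits)
qed

section \<open>The search on the reversed string and the POSIX match\<close>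

lemma reach_search:
  assumes "wf_regex R"
  shows "reach (Cat (star (Pred (ptop A))) (regex_rev R)) (rev s, 0) x \<longleftrightarrow>
    fst (loc_rev x) = s \<and> (\<exists>y. reach R (loc_rev x) y)"
proof -
  \<comment> \<open>From position 0 the prefix reaches every valid location of the reversed string,
    so a reversed match may start anywhere.\<close>
  have start: "reach (star (Pred (ptop A))) (rev s, 0) z \<longleftrightarrow> valid_loc z \<and> fst z = rev s" for z
    by (cases z) (auto simp: reach_star_top valid_loc_def loc_less_def)
  have rev: "reach (regex_rev R) z x \<longleftrightarrow> reach R (loc_rev x) (loc_rev z)" for z
    using reach_rev[OF assms, of "loc_rev z" "loc_rev x"] by simp
  have "reach (Cat (star (Pred (ptop A))) (regex_rev R)) (rev s, 0) x \<longleftrightarrow>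
      (\<exists>z. fst z = rev s \<and> reach R (loc_rev x) (loc_rev z))"
    unfolding reach_Cat start rev using reach_ordered[of R "loc_rev x"] valid_loc_rev by metis
  also have "\<dots> \<longleftrightarrow> (\<exists>y. fst y = s \<and> reach R (loc_rev x) y)"
    by (metis fst_conv loc_rev_def loc_rev_rev rev_rev_ident)
  also have "\<dots> \<longleftrightarrow> fst (loc_rev x) = s \<and> (\<exists>y. reach R (loc_rev x) y)"
    \<comment> \<open>A match stays in one string, so the condition on the string moves from its end
      to its start.\<close>
    using reach_ordered[of R "loc_rev x"] unfolding loc_less_def by metis
  finally show ?thesis .
qed

lemma ll_match_eq_None_iff:
  assumes "wf_regex R"
  shows "ll_match A s R = None \<longleftrightarrow> \<not> (\<exists>i y. reach R (s, i) y)"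
proof -
  have "ll_match A s R = None \<longleftrightarrow>
      \<not> (\<exists>x. fst (loc_rev x) = s \<and> (\<exists>y. reach R (loc_rev x) y))"
    by (auto simp: ll_match_def Let_def match_end_eq_fail_iff reach_search[OF assms] valid_loc_def)
  also have "\<dots> \<longleftrightarrow> \<not> (\<exists>i y. reach R (s, i) y)"
    by (metis fst_conv loc_rev_rev prod.collapse)
  finally show ?thesis .
qed

text \<open>Both phases maximize: the first over reversed starts, which minimizes the start itself,
  and the second over ends from that start.\<close>

lemma ll_match_posix:
  assumes "wf_regex R" and "ll_match A s R = Some p"
  shows "is_posix_match A s R p"
proof -
  let ?Q = "Cat (star (Pred (ptop A))) (regex_rev R)"
  define x where "x = match_end A (rev s, 0) ?Q"
  have x: "x \<noteq> match_fail" and p: "p = (loc_rev x, match_end A (loc_rev x) R)"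
    using assms(2) by (auto simp: ll_match_def Let_def x_def split: if_splits)
  from x obtain z where "reach ?Q (rev s, 0) z"
    using match_end_eq_fail_iff[of "(rev s, 0)" ?Q] by (auto simp: x_def valid_loc_def)
  then have "reach ?Q (rev s, 0) x"
    using reach_match_end x_def by simp
  then obtain y where s: "fst (loc_rev x) = s" and y: "reach R (loc_rev x) y"
    using reach_search[OF assms(1)] by auto
  define i where "i = snd (loc_rev x)"
  have i: "loc_rev x = (s, i)"
    using s by (cases "loc_rev x") (simp add: i_def)
  \<comment> \<open>The reversal of any start is a match end of the search, hence at most
    \<open>x\<close>; reversal turns this inequality around.\<close>
  have least: "i \<le> k" if "reach R (s, k) z" for k z
  proof -
    have "reach ?Q (rev s, 0) (loc_rev (s, k))"
      using that by (auto simp: reach_search[OF assms(1)])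
    then have "snd (loc_rev (s, k)) \<le> snd x"
      using reach_match_end(2) x_def by simp
    moreover have "x = loc_rev (s, i)"
      using i by (metis loc_rev_rev)
    ultimately show ?thesis
      by (simp add: loc_rev_def)
  qed
  have e: "reach R (s, i) (match_end A (s, i) R)"
    using reach_match_end(1) y i by simp
  then have e': "valid_loc (match_end A (s, i) R)" "fst (match_end A (s, i) R) = s"
    using reach_ordered[OF e] by (auto simp: loc_less_def)
  define j where "j = snd (match_end A (s, i) R)"
  have j: "match_end A (s, i) R = (s, j)"
    using e' by (cases "match_end A (s, i) R") (simp add: j_def)
  have greatest: "k \<le> j" if "reach R (s, i) (s, k)" for k
    using reach_match_end(2)[OF that] j by simp
  show ?thesis
    unfolding is_posix_match_def p i j
    using e e' j least greatest
    by (intro exI[of _ i] exI[of _ j]) (auto simp: reach_def is_loc_def valid_loc_def)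
qed

end

theorem theorem3:
  fixes A :: "('a, 'p) char_alg" and s :: "'a list" and R :: "'p regex"
  assumes "effective_boolean_algebra A"
    and "R \<in> regexes"
  shows "(ll_match A s R = None \<longleftrightarrow>
      \<not> (\<exists>i j. valid_loc (s, i) \<and> valid_loc (s, j) \<and> derives A (s, i) R (s, j))) \<and>
    (\<forall>p. ll_match A s R = Some p \<longrightarrow> is_posix_match A s R p)"
proof -
  interpret effective_boolean_algebra A
    by fact
  have wf: "wf_regex R"
    using assms(2) by (simp add: regexes_def)
  \<comment> \<open>Every end related to \<open>(s, i)\<close> lies in \<open>s\<close>, so ends can
    be given by positions alone.\<close>
  have "(\<exists>y. reach R (s, i) y) \<longleftrightarrow>
      (\<exists>j. valid_loc (s, i) \<and> valid_loc (s, j) \<and> derives A (s, i) R (s, j))" for i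
  proof
    assume "\<exists>y. reach R (s, i) y"
    then obtain y where y: "reach R (s, i) y"
      by blast
    moreover have "y = (s, snd y)"
      using reach_ordered[OF y] by (cases y) (auto simp: loc_less_def)
    ultimately show "\<exists>j. valid_loc (s, i) \<and> valid_loc (s, j) \<and> derives A (s, i) R (s, j)"
      using reach_ordered[OF y] by (metis reach_def)
  qed (auto simp: reach_def)
  then show ?thesis
    using ll_match_eq_None_iff[OF wf] ll_match_posix[OF wf] by metis
qed

end
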